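(* Let $n,l,k$ be positive integers. There exists an almost-balanced generalized de Bruijn sequence with parameters $(n,l,k)$ if and only if $k \geq \frac{n}{2^l}$.
   Context: A generalized de Bruijn sequence with parameters $(n,l,k)$ is a cyclic sequence of $n$ bits (elements of $\{0,1\}$) such that each binary string of length $l$ occurs at most $k$ times as a (cyclic) substring, i.e. among the $n$ cyclic windows $b_i b_{i+1}\cdots b_{i+l-1}$ (indices mod $n$), $i=0,\dots,n-1$. A binary sequence is almost-balanced if the number of $0$s and the number of $1$s differ by at most one. *)

theory Defs
  imports Complex_Main
begin

text \<open>Bits are modelled by \<^typ>\<open>bool\<close>. A cyclic sequence of n bits is represented by a list of
  length n, i.e. by a choice of starting point; all notions below are invariant under rotation.\<close>

text \<open>Indices wrap around modulo the length, also more than once when l exceeds the length.\<close>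

definition cyclic_window :: "bool list \<Rightarrow> nat \<Rightarrow> nat \<Rightarrow> bool list" where
  "cyclic_window b l i = map (\<lambda>j. b ! ((i + j) mod length b)) [0..<l]"

definition cyclic_occurrences :: "bool list \<Rightarrow> bool list \<Rightarrow> nat" where
  "cyclic_occurrences b u = card {i. i < length b \<and> cyclic_window b (length u) i = u}"

definition generalized_de_bruijn :: "nat \<Rightarrow> nat \<Rightarrow> nat \<Rightarrow> bool list \<Rightarrow> bool" where
  "generalized_de_bruijn n l k b \<longleftrightarrow>
     length b = n \<and> (\<forall>u. length u = l \<longrightarrow> cyclic_occurrences b u \<le> k)"

definition almost_balanced :: "bool list \<Rightarrow> bool" where
  "almost_balanced b \<longleftrightarrow> \<bar>int (count_list b False) - int (count_list b True)\<bar> \<le> 1"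

end

theory Submission
  imports Defs
begin

text \<open>
  Counting windows gives necessity. For sufficiency, a cyclic sequence is treated as a periodic
  function. Two such functions agreeing on a window of length \<open>l - 1\<close> can be concatenated, and their
  numbers of occurrences of words of length at most \<open>l\<close> add up. Hence prepending de Bruijn cycles of
  length \<open>2 ^ l\<close> (which are exactly balanced) reduces the problem to \<open>k = 1\<close> and \<open>n \<le> 2 ^ l\<close>.

  That case is proved by doubling. The preimages of \<open>f\<close> under the Lempel map
  \<open>g \<mapsto> (\<lambda>i. g i \<noteq> g (i + 1))\<close> come in complementary pairs; they form a single cycle of twice the
  length, or two cycles that can be concatenated as soon as \<open>f\<close> contains all the \<open>l\<close>-windows of some
  periodic word of odd weight. The resulting cycle has exactly as many zeros as ones and distinct
  windows of length \<open>l + 1\<close>. Deleting one letter of a run of \<open>l + 1\<close> equal letters removes exactly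
  one of these windows and gives the odd lengths. Containing a constant window and all windows of
  the periodic words 001 and 110 is an invariant of both operations, so everything reduces to
  explicit cycles of length at most 32.
\<close>

section \<open>Periodic functions and numbers of occurrences\<close>

definition periodic :: "nat \<Rightarrow> (nat \<Rightarrow> bool) \<Rightarrow> bool" where
  "periodic n f \<longleftrightarrow> (\<forall>i. f (i + n) = f i)"

text \<open>Words are functions whose values from \<open>l\<close> on are ignored, so constant and
  periodic words serve for every length. A sum of indicators splits over blocks of
  positions.\<close>

definition occ :: "nat \<Rightarrow> (nat \<Rightarrow> bool) \<Rightarrow> nat \<Rightarrow> (nat \<Rightarrow> bool) \<Rightarrow> nat" where
  "occ n f l u = (\<Sum>x<n. of_bool (\<forall>t<l. f (x + t) = u t))"

lemma sum_lessThan_plus: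
  fixes h :: "nat \<Rightarrow> nat"
  shows "(\<Sum>x<a + b. h x) = (\<Sum>x<a. h x) + (\<Sum>x<b. h (a + x))"
  by (induction b) (simp_all add: algebra_simps)

lemma periodic_mult: "periodic n f \<Longrightarrow> periodic (q * n) f"
  by (induction q) (auto simp: periodic_def add.assoc[symmetric] add.commute[of n])

lemma periodic_mod:
  assumes "periodic n f"
  shows "f (i mod n) = f i"
  using periodic_mult[OF assms, of "i div n"] unfolding periodic_def
  by (metis div_mult_mod_eq add.commute)

lemma periodic_shift: "periodic n f \<Longrightarrow> periodic n (\<lambda>i. f (i + s))"
  unfolding periodic_def by (metis add.assoc add.commute)

lemma periodic_Not: "periodic n (\<lambda>i. \<not> f i) = periodic n f"
  by (auto simp: periodic_def)

text \<open>A shift by one trades the term at position 0 for the term at \<open>n\<close>, and these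
  agree by periodicity.\<close>

lemma occ_shift:
  assumes "periodic n f"
  shows "occ n (\<lambda>i. f (i + s)) l u = occ n f l u"
proof (induction s)
  case (Suc s)
  define h :: "nat \<Rightarrow> nat" where "h x = of_bool (\<forall>t<l. f (x + t + s) = u t)" for x
  have "f (n + (t + s)) = f (t + s)" for t
    using assms unfolding periodic_def by (metis add.commute)
  then have hn: "h n = h 0"
    by (simp add: h_def add.assoc)
  have "(\<Sum>x<n. h (Suc x)) + h 0 = (\<Sum>x<n. h x) + h n"
    by (metis add.commute sum.lessThan_Suc_shift sum.lessThan_Suc)
  with hn have "(\<Sum>x<n. h (Suc x)) = (\<Sum>x<n. h x)"
    by simp
  then show ?case
    using Suc by (simp add: occ_def h_def)
qed simp

lemma occ_Not: "occ n (\<lambda>i. \<not> f i) l u = occ n f l (\<lambda>i. \<not> u i)"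
  unfolding occ_def by (intro sum.cong refl arg_cong[where f = of_bool]) auto

lemma occ_cong: "(\<And>t. t < l \<Longrightarrow> u t = v t) \<Longrightarrow> occ n f l u = occ n f l v"
  by (simp add: occ_def)

lemma occ_antimono: "l \<le> l' \<Longrightarrow> occ n f l' u \<le> occ n f l u"
  unfolding occ_def by (rule sum_mono) auto

lemma occ_0: "occ n f 0 u = n"
  by (simp add: occ_def)

lemma occ_pos_iff: "0 < occ n f l u \<longleftrightarrow> (\<exists>x<n. \<forall>t<l. f (x + t) = u t)"
proof -
  have "0 < occ n f l u \<longleftrightarrow> occ n f l u \<noteq> 0" by simp
  also have "\<dots> \<longleftrightarrow> (\<exists>x<n. \<forall>t<l. f (x + t) = u t)"
    unfolding occ_def by (subst sum_eq_0_iff) auto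
  finally show ?thesis .
qed

lemma occ_single: "occ n f 1 (\<lambda>_. True) + occ n f 1 (\<lambda>_. False) = n"
proof -
  have "occ n f 1 (\<lambda>_. True) + occ n f 1 (\<lambda>_. False) = (\<Sum>x<n. 1)"
    unfolding occ_def sum.distrib[symmetric] by (rule sum.cong) auto
  then show ?thesis by simp
qed

section \<open>Concatenating two cycles and deleting a letter\<close>

definition join :: "nat \<Rightarrow> (nat \<Rightarrow> bool) \<Rightarrow> nat \<Rightarrow> (nat \<Rightarrow> bool) \<Rightarrow> nat \<Rightarrow> bool" where
  "join a g b h i = (let y = i mod (a + b) in if y < a then g y else h (y - a))"

lemma periodic_join: "periodic (a + b) (join a g b h)"
  by (simp add: periodic_def join_def)

text \<open>A window leaving its block overshoots by at most \<open>l\<close> letters, and these are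
  the same at the start of either block. It reads as if its own block were repeated.\<close>

lemma occ_join:
  assumes g: "periodic a g" and h: "periodic b h"
    and agree: "\<And>t. t < l \<Longrightarrow> g t = h t"
    and L: "L \<le> Suc l"
  shows "occ (a + b) (join a g b h) L u = occ a g L u + occ b h L u"
proof -
  let ?F = "join a g b h"
  have per: "?F (x + (a + b)) = ?F x" for x
    using periodic_join[of a b g h] unfolding periodic_def by blast
  have ga: "g (x + a) = g x" and hb: "h (x + b) = h x" for x
    using g h unfolding periodic_def by blast+
  have F1: "?F x = g x" if "x < a" for x
    using that by (simp add: join_def)
  have F2: "?F (a + x) = h x" if "x < b" for x
    using that by (simp add: join_def)
  \<comment> \<open>A block may be shorter than the window, which then wraps several times. The
    overshoot \<open>s\<close> is smaller than \<open>t\<close>, hence strong induction on the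
    offset.\<close>
  have win: "t \<le> l \<longrightarrow> (\<forall>i<a. ?F (i + t) = g (i + t)) \<and> (\<forall>i<b. ?F (a + i + t) = h (i + t))" for t
  proof (induction t rule: less_induct)
    case (less t)
    show ?case
    proof (intro impI conjI allI)
      fix i assume t: "t \<le> l" and i: "i < a"
      show "?F (i + t) = g (i + t)"
      proof (cases "i + t < a")
        case False
        define s where "s = i + t - a"
        have s: "s < t" "i + t = s + a" using False i by (auto simp: s_def)
        have "?F (a + s) = h s"
        proof (cases "b = 0")
          case True
          have "h s = g s" using agree[of s] s t by simp
          moreover have "?F (a + s) = ?F (0 + s)" using per[of s] True by (simp add: add.commute)
          moreover have "?F (0 + s) = g (0 + s)" using less[OF s(1)] s t i by auto
          ultimately show ?thesis by simp
        next
          case False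
          then show ?thesis using less[OF s(1)] s t by force
        qed
        then show ?thesis using agree[of s] s t ga[of s] by (simp add: add.commute)
      qed (simp add: F1)
    next
      fix i assume t: "t \<le> l" and i: "i < b"
      show "?F (a + i + t) = h (i + t)"
      proof (cases "i + t < b")
        case True
        then show ?thesis using F2[of "i + t"] by (simp add: add.assoc)
      next
        case False
        define s where "s = i + t - b"
        have s: "s < t" "i + t = s + b" using False i by (auto simp: s_def)
        have "a + i + t = s + (a + b)" using s by simp
        then have eq: "?F (a + i + t) = ?F s" using per[of s] by metis
        have "?F s = h s"
        proof (cases "a = 0")
          case True
          then show ?thesis using less[OF s(1)] s t i by force
        next
          case False
          then have "?F s = g s" using less[OF s(1)] s t by force
          then show ?thesis using agree[of s] s t by simp
        qed
        then show ?thesis using s hb[of s] eq by simp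
      qed
    qed
  qed
  have "(\<Sum>x<a. of_bool (\<forall>t<L. ?F (x + t) = u t)) = occ a g L u"
    unfolding occ_def by (intro sum.cong arg_cong[where f = of_bool]) (use win L in auto)
  moreover have "(\<Sum>x<b. of_bool (\<forall>t<L. ?F (a + x + t) = u t)) = occ b h L u"
    unfolding occ_def by (intro sum.cong arg_cong[where f = of_bool]) (use win L in auto)
  ultimately show ?thesis
    unfolding occ_def[of "a + b"] sum_lessThan_plus by simp
qed

text \<open>Rotated so that the run comes first, \<open>f\<close> is the join of the one-letter
  cycle \<open>c\<close> with the remaining \<open>n\<close> letters, since both start with
  \<open>l\<close> letters \<open>c\<close>. The one-letter cycle contributes only constant
  words.\<close>

lemma occ_delete_loop:
  assumes f: "periodic (Suc n) f" and n: "n > 0" and c: "occ (Suc n) f (Suc l) (\<lambda>_. c) > 0"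
  obtains g where "periodic n g"
    "\<And>L u. L \<le> Suc l \<Longrightarrow> occ (Suc n) f L u = of_bool (\<forall>t<L. u t = c) + occ n g L u"
proof -
  obtain s where s: "\<forall>t<Suc l. f (s + t) = c"
    using c by (auto simp: occ_pos_iff)
  define f' where "f' i = f (i + s)" for i
  have f': "periodic (Suc n) f'"
    unfolding f'_def using f by (rule periodic_shift)
  have f'c: "f' t = c" if "t \<le> l" for t
    using s that by (simp add: f'_def add.commute[of t s])
  define g where "g i = f' (Suc (i mod n))" for i
  have g: "periodic n g"
    by (simp add: periodic_def g_def)
  have agree: "c = g t" if "t < l" for t
    using that f'c[of "Suc (t mod n)"] by (simp add: g_def Suc_le_eq le_less_trans[OF mod_less_eq_dividend])
  have "f' x = join 1 (\<lambda>_. c) n g x" for x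
  proof (cases "x mod Suc n")
    case 0
    then have "f' x = c" using periodic_mod[OF f', of x] f'c[of 0] by simp
    then show ?thesis using 0 by (simp add: join_def)
  next
    case (Suc y)
    then have "y < n" using mod_less_divisor[of "Suc n" x] by linarith
    then show ?thesis using Suc periodic_mod[OF f', of x] by (simp add: join_def g_def)
  qed
  then have F: "f' = join 1 (\<lambda>_. c) n g" by blast
  have "occ (Suc n) f L u = of_bool (\<forall>t<L. u t = c) + occ n g L u" if "L \<le> Suc l" for L u
  proof -
    have "occ (Suc n) f L u = occ (1 + n) f' L u"
      unfolding f'_def using occ_shift[OF f] by simp
    also have "\<dots> = occ 1 (\<lambda>_. c) L u + occ n g L u"
      unfolding F by (rule occ_join[where l = l]) (use g agree that in \<open>auto simp: periodic_def\<close>)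
    also have "occ 1 (\<lambda>_. c) L u = of_bool (\<forall>t<L. u t = c)"
      by (auto simp: occ_def)
    finally show ?thesis .
  qed
  with g show ?thesis using that by blast
qed

section \<open>The Lempel map and its preimages\<close>

definition lempel :: "(nat \<Rightarrow> bool) \<Rightarrow> nat \<Rightarrow> bool" where
  "lempel g i \<longleftrightarrow> g i \<noteq> g (Suc i)"

text \<open>A preimage is determined by its first letter, here \<open>False\<close>; the other
  preimage is the complement.\<close>

fun lempel_inv :: "(nat \<Rightarrow> bool) \<Rightarrow> nat \<Rightarrow> bool" where
  "lempel_inv f 0 = False"
| "lempel_inv f (Suc i) = (lempel_inv f i \<noteq> f i)"

lemma lempel_lempel_inv: "lempel (lempel_inv f) = f"
  by (auto simp: lempel_def fun_eq_iff)

text \<open>Equal differences carry agreement or disagreement of the first letters along the whole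
  window.\<close>

lemma lempel_window_eq:
  "(\<forall>t<l. lempel g (x + t) = lempel u t) \<longleftrightarrow>
     (\<forall>t<Suc l. g (x + t) = u t) \<or> (\<forall>t<Suc l. g (x + t) = (\<not> u t))"
proof
  assume D: "\<forall>t<l. lempel g (x + t) = lempel u t"
  have "(g (x + t) = u t) = (g x = u 0)" if "t \<le> l" for t
    using that
  proof (induction t)
    case (Suc t)
    then show ?case using D by (auto simp: lempel_def Suc_le_eq)
  qed simp
  then show "(\<forall>t<Suc l. g (x + t) = u t) \<or> (\<forall>t<Suc l. g (x + t) = (\<not> u t))"
    by (auto simp: less_Suc_eq_le)
next
  assume "(\<forall>t<Suc l. g (x + t) = u t) \<or> (\<forall>t<Suc l. g (x + t) = (\<not> u t))"
  moreover have "t < Suc l" "Suc t < Suc l" if "t < l" for t using that by auto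
  ultimately show "\<forall>t<l. lempel g (x + t) = lempel u t"
    unfolding lempel_def add_Suc_right[symmetric] by blast
qed

lemma occ_lempel:
  "occ m g (Suc l) u + occ m (\<lambda>i. \<not> g i) (Suc l) u = occ m (lempel g) l (lempel u)"
proof -
  have "of_bool (\<forall>t<Suc l. g (x + t) = u t) + of_bool (\<forall>t<Suc l. (\<not> g (x + t)) = u t)
      = (of_bool (\<forall>t<l. lempel g (x + t) = lempel u t) :: nat)" for x
  proof -
    have "\<not> ((\<forall>t<Suc l. g (x + t) = u t) \<and> (\<forall>t<Suc l. g (x + t) = (\<not> u t)))" by auto
    moreover have "(\<forall>t<Suc l. (\<not> g (x + t)) = u t) \<longleftrightarrow> (\<forall>t<Suc l. g (x + t) = (\<not> u t))" by auto
    ultimately show ?thesis unfolding lempel_window_eq[of l g x u] by auto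
  qed
  then show ?thesis
    unfolding occ_def sum.distrib[symmetric] by (intro sum.cong refl)
qed

text \<open>If \<open>f\<close> has odd weight per period, a preimage continues with its own
  complement and is one cycle of length \<open>m + m\<close>. Otherwise both preimages have period
  \<open>m\<close>, and \<open>meet\<close> supplies rotations of them that can be joined. The case
  \<open>L = 0\<close> yields exact balance.\<close>

lemma lempel_lift:
  assumes f: "periodic m f"
    and meet: "\<exists>i j. \<forall>t<l. lempel_inv f (i + t) \<noteq> lempel_inv f (j + t)"
  obtains F where "periodic (m + m) F"
    "\<And>L u. L \<le> l \<Longrightarrow> occ (m + m) F (Suc L) u = occ m f L (lempel u)"
proof -
  define g where "g = lempel_inv f"
  have step: "g (Suc i) = (g i \<noteq> f i)" for i by (simp add: g_def)
  have fm: "f (i + m) = f i" for i using f unfolding periodic_def by blast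
  \<comment> \<open>\<open>g m\<close> is the parity of the weight of \<open>f\<close> over one
    period.\<close>
  have gm: "(g (i + m) = g i) = (\<not> g m)" for i
  proof (induction i)
    case 0
    then show ?case by (simp add: g_def)
  next
    case (Suc i)
    then show ?case using step[of i] step[of "i + m"] fm[of i] by auto
  qed
  have D: "occ m g (Suc L) u + occ m (\<lambda>i. \<not> g i) (Suc L) u = occ m f L (lempel u)" for L u
    using occ_lempel[of m g L u] by (simp add: g_def lempel_lempel_inv)
  show ?thesis
  proof (cases "g m")
    case True
    then have neg: "g (i + m) = (\<not> g i)" for i using gm by blast
    have neg': "g (m + i) = (\<not> g i)" for i using neg[of i] by (simp add: add.commute)
    have "periodic (m + m) g"
      unfolding periodic_def by (simp add: neg add.assoc[symmetric])
    moreover have "occ (m + m) g (Suc L) u = occ m f L (lempel u)" for L u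
      unfolding D[symmetric] unfolding occ_def sum_lessThan_plus by (simp add: neg' add.assoc)
    ultimately show ?thesis using that by blast
  next
    case False
    then have g: "periodic m g" using gm by (simp add: periodic_def)
    obtain i j where ij: "\<forall>t<l. g (i + t) \<noteq> g (j + t)" using meet by (auto simp: g_def)
    define g1 where "g1 t = g (t + i)" for t
    define g2 where "g2 t = (\<not> g (t + j))" for t
    have g1: "periodic m g1" unfolding g1_def using g by (rule periodic_shift)
    have g2: "periodic m g2" unfolding g2_def periodic_Not using g by (rule periodic_shift)
    have "occ (m + m) (join m g1 m g2) (Suc L) u = occ m f L (lempel u)" if "L \<le> l" for L u
    proof -
      have "occ (m + m) (join m g1 m g2) (Suc L) u = occ m g1 (Suc L) u + occ m g2 (Suc L) u"
        by (rule occ_join[OF g1 g2, where l = l])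
          (use ij that in \<open>auto simp: g1_def g2_def add.commute\<close>)
      also have "occ m g1 (Suc L) u = occ m g (Suc L) u"
        unfolding g1_def using g by (rule occ_shift)
      also have "occ m g2 (Suc L) u = occ m (\<lambda>i. \<not> g i) (Suc L) u"
        unfolding g2_def using g by (intro occ_shift[where f = "\<lambda>i. \<not> g i"]) (simp add: periodic_Not)
      finally show ?thesis by (simp add: D)
    qed
    then show ?thesis using that periodic_join by blast
  qed
qed

text \<open>A lift of \<open>lempel q\<close> changes sign after \<open>T\<close> steps. If the two lifts of the sequence shared no
  window, the sign of its lift relative to \<open>q\<close> would be the same along all windows of \<open>lempel q\<close>.\<close>

lemma lempel_lifts_meet:
  fixes q :: "nat \<Rightarrow> bool"
  assumes occ: "\<And>r. occ m (lempel g) l (\<lambda>t. lempel q (r + t)) > 0"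
    and anti: "\<And>i. q (i + T) = (\<not> q i)"
  shows "\<exists>i j. \<forall>t<l. g (i + t) \<noteq> g (j + t)"
proof (rule ccontr)
  assume no: "\<not> ?thesis"
  \<comment> \<open>\<open>s\<close> is the sign: \<open>True\<close> means that the complement of
    the window of \<open>q\<close> at \<open>r\<close> occurs in \<open>g\<close>.\<close>
  define S where "S r s \<longleftrightarrow> (\<exists>i. \<forall>t\<le>l. g (i + t) = (q (r + t) \<noteq> s))" for r s
  have ex: "S r True \<or> S r False" for r
  proof -
    obtain x where x: "\<forall>t<l. lempel g (x + t) = lempel q (r + t)"
      using occ[of r] by (auto simp: occ_pos_iff)
    have "\<forall>t<l. lempel g (x + t) = lempel (\<lambda>t. q (r + t)) t"
      using x by (simp add: lempel_def)
    then show ?thesis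
      unfolding lempel_window_eq S_def by (auto simp: less_Suc_eq_le)
  qed
  have uniq: False if s: "S r s" and s': "S r (\<not> s)" for r s
  proof -
    obtain i j where "\<forall>t\<le>l. g (i + t) = (q (r + t) \<noteq> s)" "\<forall>t\<le>l. g (j + t) = (q (r + t) \<noteq> (\<not> s))"
      using s s' unfolding S_def by blast
    then have "\<forall>t<l. g (i + t) \<noteq> g (j + t)" by auto
    with no show False by blast
  qed
  \<comment> \<open>Consecutive windows of \<open>q\<close> overlap in \<open>l\<close> letters, so
    a change of sign would exhibit two complementary windows of \<open>g\<close>.\<close>
  have next': False if s: "S r s" and s': "S (Suc r) (\<not> s)" for r s
  proof -
    obtain i j where i: "\<forall>t\<le>l. g (i + t) = (q (r + t) \<noteq> s)"
      and j: "\<forall>t\<le>l. g (j + t) = (q (Suc r + t) \<noteq> (\<not> s))"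
      using s s' unfolding S_def by blast
    have "g (Suc i + t) \<noteq> g (j + t)" if "t < l" for t
      using i[rule_format, of "Suc t"] j[rule_format, of t] that by auto
    with no show False by blast
  qed
  obtain s where "S 0 s" using ex[of 0] by blast
  then have "S r s" for r
  proof (induction r)
    case (Suc r)
    then show ?case using next'[of r s] ex[of "Suc r"] by (cases s) auto
  qed
  then have "S T s" .
  \<comment> \<open>By \<open>anti\<close> the occurrence for \<open>r = 0\<close> also serves for
    \<open>r = T\<close>, with the opposite sign.\<close>
  moreover have "S T (\<not> s)"
    using \<open>S 0 s\<close> anti unfolding S_def by (simp add: add.commute)
  ultimately show False using uniq by blast
qed

section \<open>The doubling step\<close>

text \<open>Both the cycle 001 and its complement 110 have image 110 (up to rotation) under the Lempel map,
  so lifting reproduces them. Moreover 001 has odd weight, which makes the two lifts meet.\<close>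

definition pat :: "nat \<Rightarrow> bool" where "pat i \<longleftrightarrow> i mod 3 = 2"

lemma lempel_pat: "lempel (\<lambda>t. pat (r + t)) = (\<lambda>t. \<not> pat (r + 2 + t))"
  unfolding lempel_def pat_def fun_eq_iff by presburger

lemma lempel_not_pat: "lempel (\<lambda>t. \<not> pat (r + t)) = (\<lambda>t. \<not> pat (r + 2 + t))"
  unfolding lempel_def pat_def fun_eq_iff by presburger

lemma pat_not_const:
  assumes "l \<ge> 3"
  shows "\<not> (\<forall>t<l. pat (r + t) = c)"
proof -
  have "pat (r + 0) \<noteq> pat (r + 1) \<or> pat (r + 0) \<noteq> pat (r + 2)"
    unfolding pat_def by presburger
  then show ?thesis
    using assms by (metis less_le_trans zero_less_numeral one_less_numeral_iff semiring_norm(77) lessI numeral_3_eq_3 numeral_2_eq_2)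
qed

definition balanced :: "nat \<Rightarrow> (nat \<Rightarrow> bool) \<Rightarrow> bool" where
  "balanced n f \<longleftrightarrow> \<bar>int (occ n f 1 (\<lambda>_. True)) - int (occ n f 1 (\<lambda>_. False))\<bar> \<le> 1"

text \<open>Windows of \<open>pat\<close> make the two lifts meet, windows of its complement
  reproduce both patterns after lifting, and a constant window supplies the run from which a letter
  is deleted.\<close>

definition good :: "nat \<Rightarrow> nat \<Rightarrow> (nat \<Rightarrow> bool) \<Rightarrow> bool" where
  "good l n f \<longleftrightarrow> periodic n f \<and> balanced n f \<and> (\<forall>u. occ n f l u \<le> 1) \<and>
     (\<exists>c. occ n f l (\<lambda>_. c) > 0) \<and>
     (\<forall>r. occ n f l (\<lambda>t. pat (r + t)) > 0 \<and> occ n f l (\<lambda>t. \<not> pat (r + t)) > 0)"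

lemma good_Not: "good l n f \<Longrightarrow> good l n (\<lambda>i. \<not> f i)"
  unfolding good_def balanced_def periodic_Not occ_Not by (auto simp: ex_bool_eq abs_minus_commute)

lemma good_lift:
  assumes "good l n f" and l: "l \<ge> 2" and n: "n > 0"
  shows "(\<exists>F. good (Suc l) (2 * n) F) \<and> (\<exists>F. good (Suc l) (2 * n - 1) F)"
proof -
  \<comment> \<open>Complementing makes the constant \<open>False\<close>, which is the Lempel image
    of both constants.\<close>
  have "\<exists>f. good l n f \<and> occ n f l (\<lambda>_. False) > 0"
  proof -
    obtain c where "occ n f l (\<lambda>_. c) > 0" using assms by (auto simp: good_def)
    then show ?thesis
      using assms(1) good_Not[OF assms(1)] by (cases c) (auto simp: occ_Not intro: exI[of _ "\<lambda>i. \<not> f i"])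
  qed
  then obtain f where good: "good l n f" and f0: "occ n f l (\<lambda>_. False) > 0" by blast
  have f: "periodic n f" and f1: "\<And>u. occ n f l u \<le> 1"
    and fp: "\<And>r. occ n f l (\<lambda>t. pat (r + t)) > 0" and fp': "\<And>r. occ n f l (\<lambda>t. \<not> pat (r + t)) > 0"
    using good by (auto simp: good_def)
  \<comment> \<open>The cycle 000111 is a lift of 001; as 001 has odd weight, it is complemented
    after 3 steps.\<close>
  define q :: "nat \<Rightarrow> bool" where "q i \<longleftrightarrow> i mod 6 \<ge> 3" for i
  have q: "lempel q = pat"
    unfolding lempel_def q_def pat_def fun_eq_iff by presburger
  have "q (i + 3) = (\<not> q i)" for i unfolding q_def by presburger
  then have "\<exists>i j. \<forall>t<l. lempel_inv f (i + t) \<noteq> lempel_inv f (j + t)"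
    by (intro lempel_lifts_meet[where q = q and T = 3 and m = n]) (use fp in \<open>simp_all add: lempel_lempel_inv q\<close>)
  from lempel_lift[OF f this] obtain F where F: "periodic (n + n) F"
    and occF: "\<And>L u. L \<le> l \<Longrightarrow> occ (n + n) F (Suc L) u = occ n f L (lempel u)" by metis
  have F1: "occ (n + n) F (Suc l) u \<le> 1" for u using f1 by (simp add: occF)
  have Fc: "occ (n + n) F (Suc l) (\<lambda>_. c) > 0" for c
  proof -
    have "lempel (\<lambda>_. c) = (\<lambda>_. False)" by (simp add: lempel_def fun_eq_iff)
    then show ?thesis using f0 by (simp add: occF)
  qed
  have Fb: "occ (n + n) F 1 u = n" for u
    using occF[of 0 u] by (simp add: occ_0)
  have Fp: "occ (n + n) F (Suc l) (\<lambda>t. pat (r + t)) > 0" for r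
    using fp'[of "r + 2"] by (simp only: occF order.refl lempel_pat)
  have Fp': "occ (n + n) F (Suc l) (\<lambda>t. \<not> pat (r + t)) > 0" for r
    using fp'[of "r + 2"] by (simp only: occF order.refl lempel_not_pat)
  have "good (Suc l) (2 * n) F"
    using F F1 Fc Fp Fp' Fb unfolding good_def mult_2 balanced_def by simp
  moreover have "\<exists>G. good (Suc l) (2 * n - 1) G"
  proof -
    define N where "N = 2 * n - 1"
    have N: "N > 0" "n + n = Suc N" using n by (auto simp: N_def)
    \<comment> \<open>One \<open>True\<close> is deleted from a run of \<open>l + 1\<close>. The run
      of \<open>False\<close> remains, and so do the pattern windows, which are not constant at
      length at least 3.\<close>
    obtain G where G: "periodic N G"
      and occG: "\<And>L u. L \<le> Suc l \<Longrightarrow> occ (Suc N) F L u = of_bool (\<forall>t<L. u t = True) + occ N G L u"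
      using occ_delete_loop[of N F l True] F N Fc[of True] by (metis (full_types))
    have "occ N G (Suc l) u \<le> 1" for u
      using occG[of "Suc l" u] F1[of u] N by simp
    moreover have "occ N G (Suc l) (\<lambda>_. False) > 0"
      using occG[of "Suc l" "\<lambda>_. False"] Fc[of False] N by auto
    moreover have "occ N G (Suc l) (\<lambda>t. pat (r + t)) > 0" for r
      using occG[of "Suc l" "\<lambda>t. pat (r + t)"] Fp[of r] N pat_not_const[of "Suc l" r True] l by auto
    moreover have "occ N G (Suc l) (\<lambda>t. \<not> pat (r + t)) > 0" for r
      using occG[of "Suc l" "\<lambda>t. \<not> pat (r + t)"] Fp'[of r] N pat_not_const[of "Suc l" r False] l by auto
    moreover have "occ (Suc N) F 1 (\<lambda>_. False) = occ N G 1 (\<lambda>_. False)"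
      by (subst occG) auto
    then have "balanced N G"
      using occG[of 1 "\<lambda>_. True"] Fb[of "\<lambda>_. True"] Fb[of "\<lambda>_. False"] N by (simp add: balanced_def)
    ultimately show ?thesis using G unfolding good_def N_def by blast
  qed
  ultimately show ?thesis by blast
qed

section \<open>Translation between lists and periodic functions\<close>

lemma occ_cyclic_occurrences:
  assumes "b \<noteq> []"
  shows "occ (length b) (\<lambda>i. b ! (i mod length b)) l u = cyclic_occurrences b (map u [0..<l])"
proof -
  have "(\<forall>t<l. b ! ((x + t) mod length b) = u t) \<longleftrightarrow> cyclic_window b l x = map u [0..<l]" for x
    by (auto simp: cyclic_window_def)
  then show ?thesis
    by (simp add: occ_def cyclic_occurrences_def lessThan_def Collect_conj_eq)
qed

lemma occ_count_list:
  assumes "b \<noteq> []"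
  shows "occ (length b) (\<lambda>i. b ! (i mod length b)) 1 (\<lambda>_. c) = count_list b c"
proof -
  have "occ (length b) (\<lambda>i. b ! (i mod length b)) 1 (\<lambda>_. c) = (\<Sum>x<length b. of_bool (b ! x = c))"
    unfolding occ_def by (intro sum.cong) auto
  also have "\<dots> = count_list b c"
    by (induction b) (auto simp: sum.lessThan_Suc_shift simp del: sum.lessThan_Suc sum_of_bool_eq)
  finally show ?thesis .
qed

lemma balanced_iff_almost_balanced:
  assumes "b \<noteq> []"
  shows "balanced (length b) (\<lambda>i. b ! (i mod length b)) \<longleftrightarrow> almost_balanced b"
  unfolding balanced_def almost_balanced_def occ_count_list[OF assms] by (simp add: abs_minus_commute)

lemma cyclic_occurrences_count_list:
  "cyclic_occurrences b u = count_list (map (cyclic_window b (length u)) [0..<length b]) u"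
proof -
  have "{i. i < length b \<and> cyclic_window b (length u) i = u}
      = set (filter (\<lambda>i. u = cyclic_window b (length u) i) [0..<length b])" by auto
  then have "cyclic_occurrences b u = length (filter (\<lambda>i. u = cyclic_window b (length u) i) [0..<length b])"
    unfolding cyclic_occurrences_def by (simp only: distinct_card distinct_filter distinct_upt)
  then show ?thesis
    by (simp add: count_list_eq_length_filter filter_map o_def)
qed

lemma count_list_distinct: "distinct xs \<Longrightarrow> count_list xs x \<le> 1"
  by (induction xs) (auto simp: count_list_0_iff)

text \<open>Distinctness of the window list is an executable form of the bound 1. Together with it,
  the inequality makes \<open>l\<close> the least exponent with \<open>length b\<close> at most
  \<open>2 ^ l\<close>.\<close>

definition simple_cycle :: "nat \<Rightarrow> bool list \<Rightarrow> bool" where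
  "simple_cycle l b \<longleftrightarrow> b \<noteq> [] \<and> 2 ^ l < 2 * length b \<and> almost_balanced b \<and>
     distinct (map (cyclic_window b l) [0..<length b])"

lemma occ_simple_cycle:
  assumes "simple_cycle l b"
  shows "occ (length b) (\<lambda>i. b ! (i mod length b)) l u \<le> 1"
  using assms unfolding simple_cycle_def
  by (simp add: occ_cyclic_occurrences cyclic_occurrences_count_list count_list_distinct[simplified])

text \<open>The pattern read from \<open>r\<close> depends only on \<open>r mod 3\<close>, so
  finitely many membership checks suffice.\<close>

lemma good_simple_cycle:
  assumes b: "simple_cycle l b"
    and c: "replicate l False \<in> set (map (cyclic_window b l) [0..<length b])"
    and pat: "\<forall>r\<in>{0,1,2}. map (\<lambda>t. pat (r + t)) [0..<l] \<in> set (map (cyclic_window b l) [0..<length b]) \<and>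
       map (\<lambda>t. \<not> pat (r + t)) [0..<l] \<in> set (map (cyclic_window b l) [0..<length b])"
  shows "good l (length b) (\<lambda>i. b ! (i mod length b))"
proof -
  have b': "b \<noteq> []" "almost_balanced b" using b by (auto simp: simple_cycle_def)
  have pos: "occ (length b) (\<lambda>i. b ! (i mod length b)) l u > 0"
    if "map u [0..<l] \<in> set (map (cyclic_window b l) [0..<length b])" for u
    using that b' count_list_0_iff[of "map (cyclic_window b l) [0..<length b]" "map u [0..<l]"]
    by (simp add: occ_cyclic_occurrences cyclic_occurrences_count_list)
  have mod: "pat (r mod 3 + t) = pat (r + t)" for r t
    by (simp add: pat_def mod_add_left_eq)
  have "r mod 3 \<in> {0, 1, 2}" for r :: nat by auto
  then have "occ (length b) (\<lambda>i. b ! (i mod length b)) l (\<lambda>t. pat (r + t)) > 0 \<and>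
      occ (length b) (\<lambda>i. b ! (i mod length b)) l (\<lambda>t. \<not> pat (r + t)) > 0" for r
    using pat[rule_format, of "r mod 3"] unfolding mod by (blast intro: pos)
  moreover have "occ (length b) (\<lambda>i. b ! (i mod length b)) l (\<lambda>_. False) > 0"
    by (rule pos) (use c in \<open>simp add: map_replicate_const\<close>)
  moreover have "periodic (length b) (\<lambda>i. b ! (i mod length b))"
    by (simp add: periodic_def)
  ultimately show ?thesis
    using b' occ_simple_cycle[OF b] by (auto simp: good_def balanced_iff_almost_balanced)
qed

section \<open>Explicit cycles of length at most 32\<close>

text \<open>The cycles below were found by computer search; each short one is paired with its window
  length. The long ones need windows of length 5, and must contain those of 001 and 110; this is
  impossible for some of the lengths 9 to 16 at window length 4, hence the start at 17.\<close>

definition short_cycles :: "(nat \<times> bool list) list" where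
  "short_cycles = map (apsnd (map ((=) (1::nat)))) [
    (0, [0]),
    (1, [0,1]),
    (2, [0,0,1]),
    (2, [0,0,1,1]),
    (3, [0,0,0,1,1]),
    (3, [0,0,0,1,1,1]),
    (3, [0,0,0,1,0,1,1]),
    (3, [0,0,0,1,0,1,1,1]),
    (4, [0,0,0,0,1,0,1,1,1]),
    (4, [0,0,0,0,1,0,1,1,1,1]),
    (4, [0,0,0,0,1,0,0,1,1,1,1]),
    (4, [0,0,0,0,1,0,1,1,1,1,0,1]),
    (4, [0,0,0,0,1,0,0,1,1,0,1,1,1]),
    (4, [0,0,0,0,1,0,0,1,1,0,1,1,1,1]),
    (4, [0,0,0,0,1,0,0,1,1,0,1,0,1,1,1]),
    (4, [0,0,0,0,1,0,0,1,1,0,1,0,1,1,1,1])]"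

lemma short_cycles: "list_all (\<lambda>(l, b). simple_cycle l b) short_cycles"
  unfolding simple_cycle_def by code_simp

lemma length_short_cycles: "map (length \<circ> snd) short_cycles = [1..<17]"
  by code_simp

definition long_cycles :: "bool list list" where
  "long_cycles = map (map ((=) (1::nat))) [
    [0,0,0,0,0,1,0,0,1,0,1,1,0,1,1,1,1],
    [0,0,0,0,0,1,0,0,1,0,1,1,0,1,1,1,1,1],
    [0,0,0,0,0,1,0,0,1,0,1,0,1,1,0,1,1,1,1],
    [0,0,0,0,0,1,0,0,1,0,1,0,1,1,0,1,1,1,1,1],
    [0,0,0,0,0,1,0,0,1,0,1,0,1,1,0,1,1,1,1,0,1],
    [0,0,0,0,0,1,0,0,1,0,1,0,1,1,0,1,1,1,1,1,0,1],
    [0,0,0,0,0,1,0,0,1,0,1,0,1,1,0,0,1,1,0,1,1,1,1],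
    [0,0,0,0,0,1,0,0,1,0,1,0,1,1,0,0,1,1,0,1,1,1,1,1],
    [0,0,0,0,0,1,0,0,0,1,1,0,1,0,0,1,0,1,1,1,1,1,0,1,1],
    [0,0,0,0,0,1,0,0,0,1,1,1,0,1,0,0,1,0,1,1,0,1,1,1,1,1],
    [0,0,0,0,0,1,0,0,0,1,1,0,1,0,0,1,0,1,0,1,1,1,1,1,0,1,1],
    [0,0,0,0,0,1,0,0,0,1,1,1,0,1,0,0,1,0,1,0,1,1,0,1,1,1,1,1],
    [0,0,0,0,0,1,0,0,0,1,1,0,0,1,0,1,1,0,1,0,0,1,1,1,0,1,1,1,1],
    [0,0,0,0,0,1,0,0,0,1,1,0,0,1,0,1,1,0,1,0,0,1,1,1,0,1,1,1,1,1],
    [0,0,0,0,0,1,0,0,0,1,1,0,0,1,0,1,0,0,1,1,1,0,1,0,1,1,0,1,1,1,1],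
    [0,0,0,0,0,1,0,0,0,1,1,0,0,1,0,1,0,0,1,1,1,0,1,0,1,1,0,1,1,1,1,1]]"

lemma long_cycles:
  "list_all (\<lambda>b. simple_cycle 5 b \<and> replicate 5 False \<in> set (map (cyclic_window b 5) [0..<length b]) \<and>
     (\<forall>r\<in>{0,1,2}. map (\<lambda>t. pat (r + t)) [0..<5] \<in> set (map (cyclic_window b 5) [0..<length b]) \<and>
       map (\<lambda>t. \<not> pat (r + t)) [0..<5] \<in> set (map (cyclic_window b 5) [0..<length b]))) long_cycles"
  unfolding simple_cycle_def by code_simp

lemma length_long_cycles: "map length long_cycles = [17..<33]"
  by code_simp

section \<open>Cycles with distinct windows for every length\<close>

lemma ex_good:
  assumes "n \<ge> 17"
  shows "\<exists>l f. l \<ge> 5 \<and> 2 ^ l < 2 * n \<and> good l n f"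
  using assms
proof (induction n rule: less_induct)
  case (less n)
  show ?case
  proof (cases "n < 33")
    case True
    then have "n \<in> set (map length long_cycles)"
      using less.prems unfolding length_long_cycles set_upt atLeastLessThan_iff by linarith
    then obtain b where b: "b \<in> set long_cycles" "length b = n" by auto
    then have "good 5 n (\<lambda>i. b ! (i mod length b))"
      using long_cycles good_simple_cycle[of 5 b] unfolding list_all_iff by auto
    moreover have "2 ^ 5 < 2 * n" using less by simp
    ultimately show ?thesis by blast
  next
    case False
    \<comment> \<open>Halving rounds up because odd lengths arise by deleting a letter. From 33 on
      this gives \<open>m\<close> at least 17, so the lengths 17 to 32 are a sufficient
      base.\<close>
    define m where "m = (n + 1) div 2"
    have m: "m < n" "m \<ge> 17" "n = 2 * m \<or> n = 2 * m - 1" using False by (auto simp: m_def)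
    then obtain l f where l: "l \<ge> 5" "2 ^ l < 2 * m" and f: "good l m f"
      using less.IH by blast
    have "\<exists>F. good (Suc l) n F"
      using good_lift[OF f] l m by auto
    \<comment> \<open>Positivity of \<open>l\<close> makes \<open>2 ^ l\<close> even, so
      \<open>2 ^ l < 2 * m\<close> still gives \<open>2 ^ l < n\<close> when
      \<open>n = 2 * m - 1\<close>.\<close>
    moreover obtain l' where "l = Suc l'" using l by (cases l) auto
    then have "2 ^ Suc l < 2 * n" using l m by auto
    ultimately show ?thesis using l by (meson le_SucI)
  qed
qed

text \<open>A cycle for the least sufficient window length \<open>l'\<close> works for every larger
  \<open>l\<close>, since lengthening windows never creates repetitions.\<close>

lemma ex_simple:
  assumes "n > 0" and "n \<le> 2 ^ l"
  shows "\<exists>f. periodic n f \<and> balanced n f \<and> (\<forall>u. occ n f l u \<le> 1)"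
proof -
  have "\<exists>l' f. 2 ^ l' < 2 * n \<and> periodic n f \<and> balanced n f \<and> (\<forall>u. occ n f l' u \<le> 1)"
  proof (cases "n < 17")
    case True
    then have "n \<in> set (map (length \<circ> snd) short_cycles)"
      using assms unfolding length_short_cycles set_upt atLeastLessThan_iff by linarith
    then obtain l' b where lb: "(l', b) \<in> set short_cycles" "length b = n" by auto
    then have b: "simple_cycle l' b" using short_cycles by (auto simp: list_all_iff)
    have "periodic n (\<lambda>i. b ! (i mod length b))" using lb by (simp add: periodic_def)
    then show ?thesis
      using b occ_simple_cycle[OF b] balanced_iff_almost_balanced[of b] lb
      unfolding simple_cycle_def by blast
  next
    case False
    then obtain l' f where "2 ^ l' < 2 * n" "good l' n f" using ex_good[of n] by auto
    then show ?thesis unfolding good_def by blast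
  qed
  then obtain l' f where l': "2 ^ l' < 2 * n" and f: "periodic n f" "balanced n f" "\<And>u. occ n f l' u \<le> 1"
    by blast
  have "(2::nat) ^ l' < 2 ^ Suc l" using l' assms by simp
  then have "l' \<le> l" using power_less_imp_less_exp[of "2::nat" l' "Suc l"] by simp
  then have "occ n f l u \<le> 1" for u
    using occ_antimono[of l' l n f u] f(3)[of u] by linarith
  then show ?thesis using f by blast
qed

section \<open>Counting words and higher multiplicities\<close>

lemma finite_words: "finite {w :: bool list. length w = l}"
  using finite_lists_length_eq[of "UNIV :: bool set" l] by simp

lemma card_words: "card {w :: bool list. length w = l} = 2 ^ l"
  using card_lists_length_eq[of "UNIV :: bool set" l] by (simp add: card_UNIV_bool)

text \<open>Double counting: exactly one word of length \<open>l\<close> is read at each starting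
  position.\<close>

lemma sum_occ: "(\<Sum>w | length w = l. occ n f l ((!) w)) = n"
proof -
  have "(\<Sum>w | length w = l. of_bool (\<forall>t<l. f (x + t) = w ! t)) = (1 :: nat)" for x
  proof -
    have "(\<Sum>w | length w = l. of_bool (\<forall>t<l. f (x + t) = w ! t))
        = (\<Sum>w | length w = l. if w = map (\<lambda>t. f (x + t)) [0..<l] then 1 else 0 :: nat)"
      by (rule sum.cong) (auto simp: list_eq_iff_nth_eq)
    also have "\<dots> = 1" by (simp add: finite_words)
    finally show ?thesis .
  qed
  then show ?thesis
    unfolding occ_def by (subst sum.swap) simp
qed

text \<open>There are as many positions as words, so the bound 1 must be attained by every
  word.\<close>

lemma occ_full:
  assumes "\<And>u. occ (2 ^ l) f l u \<le> 1"
  shows "occ (2 ^ l) f l u = 1"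
proof -
  have "occ (2 ^ l) f l ((!) (map u [0..<l])) = 1"
    by (rule sum_mono_inv[where I = "{w. length w = l}" and i = "map u [0..<l]"
          and f = "\<lambda>w. occ (2 ^ l) f l ((!) w)" and g = "\<lambda>_. 1"])
      (use assms in \<open>simp_all add: sum_occ finite_words card_words\<close>)
  then show ?thesis by (subst occ_cong[where v = "(!) (map u [0..<l])"]) auto
qed

lemma even_sum_close_eq:
  fixes a b :: nat
  shows "even (a + b) \<Longrightarrow> \<bar>int a - int b\<bar> \<le> 1 \<Longrightarrow> a = b"
  by presburger

lemma ex_multiple:
  assumes "l > 0" and "n > 0" and "n \<le> k * 2 ^ l"
  shows "\<exists>f. periodic n f \<and> balanced n f \<and> (\<forall>u. occ n f l u \<le> k)"
  using assms
proof (induction k arbitrary: n)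
  case (Suc k)
  show ?case
  proof (cases "n \<le> 2 ^ l")
    case True
    then show ?thesis using ex_simple[of n l] Suc.prems by (metis One_nat_def Suc_le_mono le_trans zero_le)
  next
    case False
    define m where "m = n - 2 ^ l"
    have m: "n = 2 ^ l + m" "m > 0" "m \<le> k * 2 ^ l" using False Suc.prems by (auto simp: m_def)
    obtain f where f: "periodic m f" "balanced m f" "\<And>u. occ m f l u \<le> k"
      using Suc.IH[of m] m Suc.prems by blast
    obtain e where e: "periodic (2 ^ l) e" "balanced (2 ^ l) e" "\<And>u. occ (2 ^ l) e l u \<le> 1"
      using ex_simple[of "2 ^ l" l] by auto
    \<comment> \<open>The de Bruijn cycle \<open>e\<close> contains every word, in particular the
      initial window of \<open>f\<close>; rotating it there permits the join.\<close>
    have "occ (2 ^ l) e l f > 0" using occ_full[of l e f] e by simp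
    then obtain s where s: "\<forall>t<l. e (s + t) = f t" by (auto simp: occ_pos_iff)
    let ?e = "\<lambda>i. e (i + s)" and ?F = "join (2 ^ l) (\<lambda>i. e (i + s)) m f"
    have occ: "occ n ?F L u = occ (2 ^ l) e L u + occ m f L u" if "L \<le> l" for L u
      unfolding m(1) occ_shift[OF e(1), of s L u, symmetric]
      by (rule occ_join[where l = l])
        (use s f periodic_shift[OF e(1), of s] that in \<open>auto simp: add.commute\<close>)
    \<comment> \<open>As \<open>l > 0\<close>, the length \<open>2 ^ l\<close> is even, so
      almost-balance of \<open>e\<close> is exact and prepending it preserves the difference of
      counts in \<open>f\<close>.\<close>
    have "even (occ (2 ^ l) e 1 (\<lambda>_. True) + occ (2 ^ l) e 1 (\<lambda>_. False))"
      using Suc.prems by (simp only: occ_single) simp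
    then have "occ (2 ^ l) e 1 (\<lambda>_. True) = occ (2 ^ l) e 1 (\<lambda>_. False)"
      using e(2) even_sum_close_eq unfolding balanced_def by blast
    then have "balanced n ?F"
      using f(2) Suc.prems unfolding balanced_def by (simp add: occ)
    moreover have "occ n ?F l u \<le> Suc k" for u
      using e(3)[of u] f(3)[of u] by (simp add: occ)
    moreover have "periodic n ?F" unfolding m(1) by (rule periodic_join)
    ultimately show ?thesis by blast
  qed
qed simp

theorem theorem2:
  fixes n l k :: nat
  assumes "n > 0" and "l > 0" and "k > 0"
  shows "(\<exists>b. generalized_de_bruijn n l k b \<and> almost_balanced b) \<longleftrightarrow> real k \<ge> real n / 2 ^ l"
proof -
  have "real k \<ge> real n / 2 ^ l \<longleftrightarrow> real n \<le> real (k * 2 ^ l)"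
    by (simp add: divide_le_eq)
  then have bound: "real k \<ge> real n / 2 ^ l \<longleftrightarrow> n \<le> k * 2 ^ l"
    unfolding of_nat_le_iff .
  show ?thesis unfolding bound
  proof
    assume "\<exists>b. generalized_de_bruijn n l k b \<and> almost_balanced b"
    then obtain b where b: "length b = n" "\<And>u. length u = l \<Longrightarrow> cyclic_occurrences b u \<le> k"
      by (auto simp: generalized_de_bruijn_def)
    have "b \<noteq> []" using b assms by auto
    then have le: "occ n (\<lambda>i. b ! (i mod length b)) l u \<le> k" for u
      using b occ_cyclic_occurrences[of b l u] by simp
    \<comment> \<open>Necessity: the \<open>n\<close> windows are distributed over
      \<open>2 ^ l\<close> words, each taking at most \<open>k\<close>.\<close>
    have "n = (\<Sum>w | length w = l. occ n (\<lambda>i. b ! (i mod length b)) l ((!) w))"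
      by (simp add: sum_occ)
    also have "\<dots> \<le> (\<Sum>w :: bool list | length w = l. k)" by (rule sum_mono) (rule le)
    finally show "n \<le> k * 2 ^ l" by (simp add: card_words mult.commute)
  next
    assume "n \<le> k * 2 ^ l"
    then obtain f where f: "periodic n f" "balanced n f" "\<And>u. occ n f l u \<le> k"
      using ex_multiple assms by blast
    \<comment> \<open>One period of \<open>f\<close> is the required list; indexing it modulo
      \<open>n\<close> gives back \<open>f\<close>.\<close>
    define b where "b = map f [0..<n]"
    have b: "length b = n" "b \<noteq> []" using assms by (auto simp: b_def)
    have bf: "(\<lambda>i. b ! (i mod length b)) = f"
      using assms periodic_mod[OF f(1)] by (auto simp: b_def)
    have "almost_balanced b"
      using f(2) balanced_iff_almost_balanced[OF b(2)] unfolding bf unfolding b(1) by simp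
    moreover have "cyclic_occurrences b (map u [0..<l]) \<le> k" for u
      using f(3)[of u] occ_cyclic_occurrences[OF b(2), of l u] unfolding bf unfolding b(1) by simp
    moreover have "map ((!) u) [0..<l] = u" if "length u = l" for u :: "bool list"
      using that map_nth by blast
    ultimately show "\<exists>b. generalized_de_bruijn n l k b \<and> almost_balanced b"
      unfolding generalized_de_bruijn_def using b by metis
  qed
qed

end
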